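(* Let $q$ be a prime power, $\varepsilon\in\{0,1\}$ and $\gamma\in\mathbb{F}_{q^5}^*$. Let $L^\varepsilon_\gamma=L_{W^\varepsilon_\gamma}$ be the $\mathbb{F}_q$-linear set of $\mathrm{PG}(1,q^5)$ defined by \[ W^0_\gamma=\{(x,x^q+\gamma h): x\in\mathbb{F}_{q^5},\ \mathrm{Tr}_{q^5/q}(x)=0,\ h\in\mathbb{F}_q\},\qquad W^1_\gamma=\{(x,x^q+\gamma\,\mathrm{Tr}_{q^5/q}(x)): x\in\mathbb{F}_{q^5}\}. \] Then $L^\varepsilon_\gamma$ has a point of weight two if there exists $\theta\in\mathbb{F}_{q^5}\setminus\mathbb{F}_q$ such that \[ \begin{cases} \mathrm{Tr}_{q^5/q}\bigl(\gamma(\theta^q-\theta)^{q+q^2+q^3+q^4}\bigr)=0,\\ \mathrm{Tr}_{q^5/q}\bigl(\gamma\theta(\theta^q-\theta)^{q+q^2+q^3+q^4}\bigr)=\varepsilon\,\mathrm{N}_{q^5/q}(\theta^q-\theta). \end{cases} \]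
   Context: For an $\mathbb{F}_q$-subspace $U$ of $\mathbb{F}_{q^5}^2$, $L_U=\{\langle \mathbf{u}\rangle_{\mathbb{F}_{q^5}}:\mathbf{u}\in U\setminus\{\mathbf 0\}\}\subseteq\mathrm{PG}(1,q^5)$. The weight of a point $\langle\mathbf v\rangle_{\mathbb{F}_{q^5}}$ of $L_U$ (with respect to $U$) is $\dim_{\mathbb{F}_q}(U\cap\langle\mathbf v\rangle_{\mathbb{F}_{q^5}})$; for $L^\varepsilon_\gamma$ the weight is taken with respect to $W^\varepsilon_\gamma$. $\mathrm{Tr}_{q^5/q}(x)=x+x^q+x^{q^2}+x^{q^3}+x^{q^4}$ and $\mathrm{N}_{q^5/q}(x)=x^{1+q+q^2+q^3+q^4}$. *)

theory Defs
  imports "HOL-Analysis.Analysis" "HOL-Number_Theory.Prime_Powers"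
begin

text \<open>
  The field \<open>\<F>\<^sub>q\<close> and its extension of degree 5 are two field types \<open>'k\<close> and \<open>'a\<close>
  related by an embedding \<open>\<iota>\<close>; the subfield \<open>\<F>\<^sub>q\<close> is \<open>range \<iota>\<close>. Having \<open>'k\<close> as a type of its own makes the
  library dimension of a \<open>'k\<close>-space available. Injectivity of \<open>\<iota>\<close> is automatic.
\<close>

locale field_embedding =
  fixes \<iota> :: "'k::field \<Rightarrow> 'a::field"
  assumes hom_one: "\<iota> 1 = 1"
    and hom_add: "\<iota> (x + y) = \<iota> x + \<iota> y"
    and hom_mult: "\<iota> (x * y) = \<iota> x * \<iota> y"

definition restr_scale :: "('k::field \<Rightarrow> 'a::field) \<Rightarrow> 'k \<Rightarrow> 'a^2 \<Rightarrow> 'a^2" where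
  "restr_scale \<iota> c v = \<iota> c *s v"

lemma vector_space_restr_scale:
  assumes "field_embedding \<iota>"
  shows "vector_space (restr_scale \<iota>)"
proof -
  interpret field_embedding \<iota> by fact
  show ?thesis
    by unfold_locales
      (simp_all add: restr_scale_def hom_one hom_add hom_mult vec_eq_iff algebra_simps)
qed

text \<open>Points of the projective line are the one-dimensional subspaces of \<open>'a^2\<close>.\<close>

definition linear_set :: "('a::field^2) set \<Rightarrow> ('a^2) set set" where
  "linear_set U = {vec.span {u} | u. u \<in> U - {0}}"

definition weight :: "('k::field \<Rightarrow> 'a::field) \<Rightarrow> ('a^2) set \<Rightarrow> ('a^2) set \<Rightarrow> nat" where
  "weight \<iota> U P = vector_space.dim (restr_scale \<iota>) (U \<inter> P)"

definition Tr5 :: "nat \<Rightarrow> 'a::field \<Rightarrow> 'a" where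
  "Tr5 q x = x + x^q + x^(q^2) + x^(q^3) + x^(q^4)"

definition N5 :: "nat \<Rightarrow> 'a::field \<Rightarrow> 'a" where
  "N5 q x = x^(1 + q + q^2 + q^3 + q^4)"

definition W0 :: "('k::field \<Rightarrow> 'a::field) \<Rightarrow> nat \<Rightarrow> 'a \<Rightarrow> ('a^2) set" where
  "W0 \<iota> q \<gamma> = {vector [x, x^q + \<gamma> * \<iota> h] | x h. Tr5 q x = 0}"

definition W1 :: "nat \<Rightarrow> 'a::field \<Rightarrow> ('a^2) set" where
  "W1 q \<gamma> = {vector [x, x^q + \<gamma> * Tr5 q x] | x. True}"

definition W :: "('k::field \<Rightarrow> 'a::field) \<Rightarrow> nat \<Rightarrow> nat \<Rightarrow> 'a \<Rightarrow> ('a^2) set" where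
  "W \<iota> q \<epsilon> \<gamma> = (if \<epsilon> = 0 then W0 \<iota> q \<gamma> else W1 q \<gamma>)"

end

theory Submission
  imports Defs "HOL-Number_Theory.Residues"
begin

text \<open>
  Write \<open>d = \<theta>\<^sup>q - \<theta>\<close>. As \<open>N(d)/d\<close> is the power of \<open>d\<close> in the statement, the hypotheses say \<open>Tr(\<gamma>/d) = 0\<close> and
  \<open>Tr(\<gamma>\<theta>/d) = \<epsilon>\<close>. Let \<open>e\<close> be the \<open>q\<close>-th root of \<open>d\<close>, so that \<open>e = \<theta> - \<theta>'\<close> with
  \<open>\<theta>'\<close> the \<open>q\<close>-th root of \<open>\<theta>\<close>. The point of weight two is spanned by \<open>(e, d)\<close>. This vector lies in
  \<open>W\<close> because \<open>Tr(e) = 0\<close>. A multiple \<open>c(e, d)\<close> lies in \<open>W\<close> iff \<open>c - c\<^sup>q = h\<gamma>/d\<close> and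
  \<open>Tr(ce) = \<epsilon>h\<close> for some \<open>h \<in> \<F>\<^sub>q\<close>. By the additive form of Hilbert's Theorem 90 there is \<open>t\<close>
  with \<open>t - t\<^sup>q = \<gamma>/d\<close>, and then \<open>Tr(te) = Tr(\<theta>(t - t\<^sup>q)) = \<epsilon>\<close>. Hence the admissible \<open>c\<close> are
  exactly the elements of \<open>\<F>\<^sub>q + \<F>\<^sub>q t\<close>.
\<close>

section \<open>Finite fields: the order and the characteristic\<close>

text \<open>Multiplication by a nonzero \<open>x\<close> permutes the nonzero elements, so their
  product absorbs the factor \<open>x ^ card ?U\<close>.\<close>

lemma power_CARD_eq_self:
  fixes x :: "'a::{field,finite}"
  shows "x ^ CARD('a) = x"
proof (cases "x = 0")
  case False
  let ?U = "UNIV - {0::'a}"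
  have "bij_betw ((*) x) ?U ?U"
    by (rule bij_betwI[where g = "\<lambda>y. y / x"]) (use False in auto)
  then have "(\<Prod>y\<in>?U. y) = (\<Prod>y\<in>?U. x * y)"
    by (rule prod.reindex_bij_betw[symmetric])
  also have "\<dots> = x ^ card ?U * (\<Prod>y\<in>?U. y)"
    by (simp add: prod.distrib)
  finally have "x ^ card ?U = 1"
    by simp
  moreover have "CARD('a) = Suc (card ?U)"
    by (simp add: card_Suc_Diff1)
  ultimately show ?thesis
    by (simp only: power_Suc mult_1_right)
qed simp

text \<open>The characteristic is a prime dividing the order of the field, hence the prime
  underlying \<open>q\<close>. This form of \<open>q\<close> is what the freshman's dream needs to
  make \<open>x ^ q\<close> additive.\<close>

lemma CHAR_power_eq_primepow:
  assumes "primepow q" and "CARD('a::{field,finite}) = q ^ m"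
  obtains n where "q = CHAR('a) ^ n"
proof -
  obtain p n where p: "prime p" and q: "q = p ^ n"
    using assms(1) by (auto simp: primepow_def)
  have prime: "prime CHAR('a)"
    by (intro prime_CHAR_semidom finite_imp_CHAR_pos) simp
  have "CHAR('a) dvd p ^ (n * m)"
    using CHAR_dvd_CARD[where 'a = 'a] assms(2) q by (simp add: power_mult)
  then have "CHAR('a) dvd p"
    using prime prime_dvd_power by blast
  then have "CHAR('a) = p"
    using prime p primes_dvd_imp_eq by blast
  with q that show ?thesis
    by blast
qed

section \<open>The Frobenius map and its fixed field\<close>

locale quintic_extension = field_embedding \<iota>
  for \<iota> :: "'k::{field,finite} \<Rightarrow> 'a::{field,finite}" +
  fixes q :: nat
  assumes primepow: "primepow q"
    and card_base: "CARD('k) = q"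
    and card_ext: "CARD('a) = q ^ 5"
begin

definition frob :: "'a \<Rightarrow> 'a" where
  "frob x = x ^ q"

lemma q_gt_1: "q > 1"
  using primepow by (simp add: primepow_gt_Suc_0)

lemma frob_add: "frob (x + y) = frob x + frob y"
proof -
  obtain n where "q = CHAR('a) ^ n"
    using CHAR_power_eq_primepow[OF primepow card_ext] .
  moreover have "prime CHAR('a)"
    by (intro prime_CHAR_semidom finite_imp_CHAR_pos) simp
  ultimately show ?thesis
    unfolding frob_def by (intro freshmans_dream')
qed

lemma frob_0 [simp]: "frob 0 = 0"
  using q_gt_1 by (simp add: frob_def)

lemma frob_1 [simp]: "frob 1 = 1"
  by (simp add: frob_def)

lemma frob_eq_0_iff [simp]: "frob x = 0 \<longleftrightarrow> x = 0"
  using q_gt_1 by (simp add: frob_def)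

lemma frob_minus: "frob (- x) = - frob x"
  using frob_add[of x "- x"] by (simp add: add_eq_0_iff)

lemma frob_diff: "frob (x - y) = frob x - frob y"
  using frob_add[of x "- y"] by (simp add: frob_minus)

lemma frob_mult: "frob (x * y) = frob x * frob y"
  by (simp add: frob_def power_mult_distrib)

lemma frob_divide: "frob (x / y) = frob x / frob y"
  by (simp add: frob_def power_divide)

lemmas frob_hom = frob_add frob_diff frob_minus frob_mult frob_divide

lemma power_q_eq_frob:
  "x ^ q = frob x" "x ^ q\<^sup>2 = frob (frob x)" "x ^ q ^ 3 = frob (frob (frob x))"
  "x ^ q ^ 4 = frob (frob (frob (frob x)))"
  by (simp_all add: frob_def power2_eq_square power3_eq_cube power4_eq_xxxx power_mult)

lemma frob_frob_frob_frob_frob [simp]: "frob (frob (frob (frob (frob x)))) = x"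
proof -
  have "q ^ 5 = q ^ 4 * q"
    by (simp add: eval_nat_numeral)
  then have "x ^ CARD('a) = (x ^ q ^ 4) ^ q"
    by (simp only: card_ext power_mult)
  then show ?thesis
    by (simp only: power_CARD_eq_self power_q_eq_frob)
qed

lemma embed_0 [simp]: "\<iota> 0 = 0"
  using hom_add[of 0 0] by (metis add_0 add_cancel_left_left)

lemma embed_diff: "\<iota> (x - y) = \<iota> x - \<iota> y"
  using hom_add[of "x - y" y] by (simp add: algebra_simps)

lemma inj_embed: "inj \<iota>"
proof (rule injI)
  fix x y assume eq: "\<iota> x = \<iota> y"
  show "x = y"
  proof (rule ccontr)
    assume "x \<noteq> y"
    then have "\<iota> ((x - y) * inverse (x - y)) = 1"
      by (simp add: hom_one)
    with eq show False
      by (simp only: hom_mult embed_diff) simp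
  qed
qed

lemma embed_power: "\<iota> (x ^ n) = \<iota> x ^ n"
  by (induction n) (simp_all add: hom_one hom_mult)

lemma frob_embed [simp]: "frob (\<iota> x) = \<iota> x"
  using power_CARD_eq_self[of x] by (simp add: frob_def card_base flip: embed_power)

text \<open>The polynomial X^q - X has at most \<open>q\<close> roots, and the \<open>q\<close>
  elements of \<open>range \<iota>\<close> are already roots.\<close>

lemma frob_eq_self_iff: "frob x = x \<longleftrightarrow> x \<in> range \<iota>"
proof -
  define p :: "'a poly" where "p = Polynomial.monom 1 q - Polynomial.monom 1 1"
  have "Polynomial.coeff p q = 1"
    using q_gt_1 by (simp add: p_def)
  then have "p \<noteq> 0"
    by auto
  moreover have "degree p \<le> q"
    unfolding p_def using q_gt_1 by (intro degree_diff_le) (auto simp: degree_monom_eq)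
  ultimately have "card {x. poly p x = 0} \<le> q"
    using card_poly_roots_bound[of p] by simp
  moreover have "{x. poly p x = 0} = {x. frob x = x}"
    by (simp add: p_def poly_monom frob_def)
  moreover have "card (range \<iota>) = q"
    using card_image[OF inj_embed] by (simp add: card_base)
  moreover have "range \<iota> \<subseteq> {x. frob x = x}"
    by auto
  ultimately have "range \<iota> = {x. frob x = x}"
    by (intro card_seteq) simp_all
  then show ?thesis
    by blast
qed

section \<open>Trace, norm and the additive Hilbert 90\<close>

lemma Tr5_frob_sum:
  "Tr5 q x = x + frob x + frob (frob x) + frob (frob (frob x)) + frob (frob (frob (frob x)))"
  by (simp add: Tr5_def power_q_eq_frob)

lemma frob_Tr5: "frob (Tr5 q x) = Tr5 q x"
  by (simp add: Tr5_frob_sum frob_hom)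

lemma Tr5_diff: "Tr5 q (x - y) = Tr5 q x - Tr5 q (y :: 'a)"
  by (simp add: Tr5_frob_sum frob_hom)

lemma Tr5_frob: "Tr5 q (frob x) = Tr5 q x"
  by (simp add: Tr5_frob_sum)

lemma Tr5_fixed_mult:
  assumes "frob c = c"
  shows "Tr5 q (c * x) = c * Tr5 q x"
  using assms by (simp add: Tr5_frob_sum frob_hom algebra_simps)

lemma frob_N5: "frob (N5 q x) = N5 q x"
  by (simp add: N5_def power_add power_q_eq_frob frob_hom)

text \<open>The trace is a polynomial function of degree \<open>q ^ 4\<close>, too small to vanish
  on all \<open>q ^ 5\<close> elements.\<close>

lemma ex_Tr5_neq_0: "\<exists>s::'a. Tr5 q s \<noteq> 0"
proof (rule ccontr)
  assume "\<not> ?thesis"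
  then have zero: "Tr5 q s = 0" for s :: 'a
    by simp
  define p :: "'a poly" where
    "p = Polynomial.monom 1 1 + Polynomial.monom 1 q + Polynomial.monom 1 (q\<^sup>2)
       + Polynomial.monom 1 (q ^ 3) + Polynomial.monom 1 (q ^ 4)"
  have less: "q ^ i < q ^ 4" if "i < 4" for i
    using q_gt_1 that by simp
  note ineqs = less[of 0, simplified] less[of 1, simplified] less[of 2] less[of 3]
  have "Polynomial.coeff p (q ^ 4) = 1"
    using ineqs by (simp add: p_def)
  then have "p \<noteq> 0"
    by auto
  moreover have "degree p \<le> q ^ 4"
    unfolding p_def using ineqs
    by (intro degree_add_le) (auto simp: degree_monom_eq)
  ultimately have "card {x. poly p x = 0} \<le> q ^ 4"
    using card_poly_roots_bound[of p] by simp
  moreover have "{x. poly p x = 0} = UNIV"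
    using zero by (auto simp: p_def poly_monom Tr5_def)
  ultimately show False
    using q_gt_1 by (simp add: card_ext)
qed

lemma additive_Hilbert_90:
  assumes "Tr5 q u = 0"
  obtains t where "t - frob t = u"
proof -
  obtain s :: 'a where s: "Tr5 q s \<noteq> 0"
    using ex_Tr5_neq_0 by blast
  \<comment> \<open>Hilbert's sum: the iterates of \<open>s\<close> carry partial sums of the trace
    of \<open>u\<close>. In \<open>t - frob t\<close> each of them keeps the coefficient
    \<open>u\<close>; for \<open>s\<close> itself, reached by wrapping around, this uses that
    \<open>u\<close> has trace 0.\<close>
  define t where
    "t = u * frob s + (u + frob u) * frob (frob s)
       + (u + frob u + frob (frob u)) * frob (frob (frob s))
       + (u + frob u + frob (frob u) + frob (frob (frob u))) * frob (frob (frob (frob s)))"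
  have last: "frob (frob (frob (frob u))) = - (u + frob u + frob (frob u) + frob (frob (frob u)))"
    using assms by (simp add: Tr5_frob_sum add_eq_0_iff)
  have "t - frob t = u * Tr5 q s"
    by (simp add: t_def Tr5_frob_sum frob_hom last algebra_simps)
  then have "t / Tr5 q s - frob (t / Tr5 q s) = u"
    using s by (simp add: frob_divide frob_Tr5 flip: diff_divide_distrib)
  then show ?thesis
    by (rule that)
qed

section \<open>Membership in \<open>W\<close> and points of weight two\<close>

text \<open>One description for both families: for \<epsilon> = 0 the trace vanishes and
  \<open>h\<close> is free, for \<epsilon> = 1 the trace determines \<open>h\<close>, being an
  element of the small field.\<close>

lemma mem_W_iff:
  assumes "\<epsilon> \<in> {0, 1}"
  shows "v \<in> W \<iota> q \<epsilon> \<gamma> \<longleftrightarrow>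
    (\<exists>h. v $ 2 = frob (v $ 1) + \<gamma> * \<iota> h \<and> Tr5 q (v $ 1) = of_nat \<epsilon> * \<iota> h)"
proof -
  have vector_eq: "v = vector [x, y] \<longleftrightarrow> x = v $ 1 \<and> v $ 2 = y" for x y
    by (auto simp: vec_eq_iff forall_2)
  show ?thesis
  proof (cases "\<epsilon> = 0")
    case True
    then show ?thesis
      by (auto simp: W_def W0_def frob_def vector_eq)
  next
    case False
    with assms have "\<epsilon> = 1"
      by simp
    have "Tr5 q (v $ 1) \<in> range \<iota>"
      by (rule frob_eq_self_iff[THEN iffD1, OF frob_Tr5])
    then obtain k where k: "Tr5 q (v $ 1) = \<iota> k"
      by (rule imageE)
    have "v \<in> W \<iota> q \<epsilon> \<gamma> \<longleftrightarrow> v $ 2 = frob (v $ 1) + \<gamma> * Tr5 q (v $ 1)"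
      using \<open>\<epsilon> = 1\<close> by (auto simp: W_def W1_def frob_def vector_eq)
    also have "\<dots> \<longleftrightarrow> (\<exists>h. v $ 2 = frob (v $ 1) + \<gamma> * \<iota> h \<and> Tr5 q (v $ 1) = \<iota> h)"
      using k by metis
    finally show ?thesis
      using \<open>\<epsilon> = 1\<close> by simp
  qed
qed

text \<open>The pair \<open>v\<close>, \<open>t *s v\<close> is a basis of
  \<open>U \<inter> vec.span {v}\<close> over the small field: it spans by the last assumption, and
  is independent as \<open>t\<close> lies outside \<open>range \<iota>\<close>.\<close>

lemma weight_eq_2I:
  assumes v: "v \<in> U" and tv: "t *s v \<in> U" and "v \<noteq> 0" and t: "t \<notin> range \<iota>"
    and U: "\<And>c. c *s v \<in> U \<Longrightarrow> \<exists>a b. c = \<iota> a + \<iota> b * t"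
  shows "weight \<iota> U (vec.span {v}) = 2"
proof -
  interpret R: vector_space "restr_scale \<iota>"
    by (rule vector_space_restr_scale) unfold_locales
  have neq_scale: "t *s v \<noteq> \<iota> k *s v" for k
  proof
    assume "t *s v = \<iota> k *s v"
    then have "t = \<iota> k"
      using \<open>v \<noteq> 0\<close> by (simp only: vec.scale_cancel_right) simp
    with t show False
      by simp
  qed
  have neq: "t *s v \<noteq> v"
    using neq_scale[of 1] by (simp add: hom_one)
  have "t *s v \<notin> R.span {v}"
    unfolding R.span_singleton restr_scale_def using neq_scale by blast
  then have indep: "R.independent {t *s v, v}"
    using \<open>v \<noteq> 0\<close> by (intro R.independent_insertI) (simp_all add: R.independent_empty)
  have "U \<inter> vec.span {v} \<subseteq> R.span {t *s v, v}"
  proof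
    fix w assume "w \<in> U \<inter> vec.span {v}"
    then obtain c where w: "w = c *s v" and "c *s v \<in> U"
      by (auto simp: vec.span_singleton)
    then obtain a b where "c = \<iota> a + \<iota> b * t"
      using U by blast
    then have "w = restr_scale \<iota> a v + restr_scale \<iota> b (t *s v)"
      by (simp add: w restr_scale_def vec.scale_left_distrib)
    then show "w \<in> R.span {t *s v, v}"
      by (simp add: R.span_add R.span_scale R.span_base)
  qed
  moreover have "{t *s v, v} \<subseteq> U \<inter> vec.span {v}"
    using v tv by (auto intro: vec.span_base vec.span_scale)
  ultimately show ?thesis
    unfolding weight_def using indep neq by (intro R.dim_unique) auto
qed

lemma ex_weight_2:
  assumes \<epsilon>: "\<epsilon> \<in> {0, 1}" and "\<gamma> \<noteq> 0" and \<theta>: "\<theta> \<notin> range \<iota>"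
    and tr0: "Tr5 q (\<gamma> / (frob \<theta> - \<theta>)) = 0"
    and tr1: "Tr5 q (\<gamma> * \<theta> / (frob \<theta> - \<theta>)) = of_nat \<epsilon>"
  shows "\<exists>P \<in> linear_set (W \<iota> q \<epsilon> \<gamma>). weight \<iota> (W \<iota> q \<epsilon> \<gamma>) P = 2"
proof -
  define d where "d = frob \<theta> - \<theta>"
  have "d \<noteq> 0"
    using \<theta> by (auto simp: d_def simp flip: frob_eq_self_iff)
  \<comment> \<open>The fifth iterate of \<open>frob\<close> is the identity, so the fourth is its
    inverse.\<close>
  define \<theta>' where "\<theta>' = frob (frob (frob (frob \<theta>)))"
  have frob_\<theta>': "frob \<theta>' = \<theta>"
    by (simp add: \<theta>'_def)
  define e where "e = \<theta> - \<theta>'"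
  have frob_e: "frob e = d"
    by (simp add: e_def d_def frob_diff frob_\<theta>')
  \<comment> \<open>The trace is Frobenius-invariant, so \<open>c * \<theta>'\<close> may be
    replaced by \<open>frob c * \<theta>\<close>; the trace condition then depends on
    \<open>c - frob c\<close> only.\<close>
  have Tr_mult_e: "Tr5 q (c * e) = Tr5 q (\<theta> * (c - frob c))" for c
  proof -
    have "Tr5 q (c * \<theta>') = Tr5 q (frob c * \<theta>)"
      using Tr5_frob[of "c * \<theta>'"] by (simp add: frob_mult frob_\<theta>')
    then show ?thesis
      by (simp add: e_def right_diff_distrib Tr5_diff mult.commute)
  qed
  obtain t where t: "t - frob t = \<gamma> / d"
    by (rule additive_Hilbert_90[OF tr0[folded d_def]])
  \<comment> \<open>A fixed \<open>t\<close> would force \<gamma>/d = 0.\<close>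
  have t_notin: "t \<notin> range \<iota>"
    using t \<open>\<gamma> \<noteq> 0\<close> \<open>d \<noteq> 0\<close> by (auto simp flip: frob_eq_self_iff)
  define v :: "'a^2" where "v = vector [e, d]"
  have "v \<noteq> 0"
    using \<open>d \<noteq> 0\<close> by (auto simp: v_def vec_eq_iff forall_2)
  have mem_iff: "c *s v \<in> W \<iota> q \<epsilon> \<gamma> \<longleftrightarrow>
      (\<exists>h. c - frob c = \<iota> h * (\<gamma> / d) \<and> Tr5 q (c * e) = of_nat \<epsilon> * \<iota> h)" for c
  proof -
    have "c * d = frob c * d + \<gamma> * \<iota> h \<longleftrightarrow> c - frob c = \<iota> h * (\<gamma> / d)" for h
      using \<open>d \<noteq> 0\<close> by (auto simp: field_simps)
    then show ?thesis
      by (simp add: mem_W_iff[OF \<epsilon>] v_def frob_mult frob_e)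
  qed
  have v_mem: "v \<in> W \<iota> q \<epsilon> \<gamma>"
  proof -
    have "1 *s v \<in> W \<iota> q \<epsilon> \<gamma>"
      unfolding mem_iff using Tr_mult_e[of 1] by (intro exI[of _ 0]) (simp add: Tr5_frob_sum)
    then show ?thesis
      by simp
  qed
  moreover have tv_mem: "t *s v \<in> W \<iota> q \<epsilon> \<gamma>"
    unfolding mem_iff Tr_mult_e t using tr1
    by (intro exI[of _ 1]) (simp add: hom_one d_def mult.commute)
  moreover have "\<exists>a b. c = \<iota> a + \<iota> b * t" if "c *s v \<in> W \<iota> q \<epsilon> \<gamma>" for c
  proof -
    obtain h where "c - frob c = \<iota> h * (\<gamma> / d)"
      using \<open>c *s v \<in> W \<iota> q \<epsilon> \<gamma>\<close> mem_iff by blast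
    \<comment> \<open>Both \<open>c\<close> and \<open>\<iota> h * t\<close> solve the same additive
      equation, so their difference is fixed by \<open>frob\<close>.\<close>
    then have "frob c = c - \<iota> h * (t - frob t)"
      by (simp add: t eq_diff_eq diff_eq_eq add.commute)
    then have "frob (c - \<iota> h * t) = c - \<iota> h * t"
      by (simp add: frob_hom right_diff_distrib)
    then have "c - \<iota> h * t \<in> range \<iota>"
      by (simp only: frob_eq_self_iff)
    then obtain a where "c - \<iota> h * t = \<iota> a"
      by (rule imageE)
    then have "c = \<iota> a + \<iota> h * t"
      by (simp add: diff_eq_eq)
    then show ?thesis
      by blast
  qed
  ultimately have "weight \<iota> (W \<iota> q \<epsilon> \<gamma>) (vec.span {v}) = 2"
    using \<open>v \<noteq> 0\<close> t_notin by (intro weight_eq_2I)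
  moreover have "vec.span {v} \<in> linear_set (W \<iota> q \<epsilon> \<gamma>)"
    using v_mem \<open>v \<noteq> 0\<close> by (auto simp: linear_set_def)
  ultimately show ?thesis
    by blast
qed

text \<open>The power of \<open>d\<close> is its norm divided by \<open>d\<close>, and the norm,
  fixed by \<open>frob\<close>, comes out of the trace.\<close>

lemma Tr5_mult_power_eq:
  fixes d x :: 'a
  assumes "d \<noteq> 0"
  shows "Tr5 q (x * d ^ (q + q\<^sup>2 + q ^ 3 + q ^ 4)) = N5 q d * Tr5 q (x / d)"
proof -
  have "x * d ^ (q + q\<^sup>2 + q ^ 3 + q ^ 4) = N5 q d * (x / d)"
    using assms by (simp add: N5_def power_add)
  then show ?thesis
    by (simp only: Tr5_fixed_mult frob_N5)
qed

end

theorem theorem3p1: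
  fixes \<iota> :: "'k::{field,finite} \<Rightarrow> 'a::{field,finite}"
    and q \<epsilon> :: nat and \<gamma> :: 'a
  assumes "primepow q"
    and "CARD('k) = q" and "CARD('a) = q^5"
    and "field_embedding \<iota>"
    and "\<epsilon> \<in> {0, 1}" and "\<gamma> \<noteq> 0"
    and "\<exists>\<theta>. \<theta> \<notin> range \<iota> \<and>
           Tr5 q (\<gamma> * (\<theta>^q - \<theta>)^(q + q^2 + q^3 + q^4)) = 0 \<and>
           Tr5 q (\<gamma> * \<theta> * (\<theta>^q - \<theta>)^(q + q^2 + q^3 + q^4)) = of_nat \<epsilon> * N5 q (\<theta>^q - \<theta>)"
  shows "\<exists>P \<in> linear_set (W \<iota> q \<epsilon> \<gamma>). weight \<iota> (W \<iota> q \<epsilon> \<gamma>) P = 2"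
proof -
  interpret field_embedding \<iota> by fact
  interpret quintic_extension \<iota> q by unfold_locales fact+
  obtain \<theta> where \<theta>: "\<theta> \<notin> range \<iota>"
    and tr: "Tr5 q (\<gamma> * (\<theta>^q - \<theta>)^(q + q^2 + q^3 + q^4)) = 0"
      "Tr5 q (\<gamma> * \<theta> * (\<theta>^q - \<theta>)^(q + q^2 + q^3 + q^4)) = of_nat \<epsilon> * N5 q (\<theta>^q - \<theta>)"
    using assms(7) by blast
  let ?d = "\<theta>^q - \<theta>"
  have d: "?d = frob \<theta> - \<theta>"
    by (simp add: frob_def)
  have "?d \<noteq> 0"
    using \<theta> by (simp add: d flip: frob_eq_self_iff)
  \<comment> \<open>This lets the norm be cancelled from both trace conditions.\<close>
  moreover from this have "N5 q ?d \<noteq> 0"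
    by (simp add: N5_def)
  ultimately have "Tr5 q (\<gamma> / ?d) = 0" "Tr5 q (\<gamma> * \<theta> / ?d) = of_nat \<epsilon>"
    using tr by (simp_all add: Tr5_mult_power_eq)
  with assms(5,6) \<theta> show ?thesis
    unfolding d by (rule ex_weight_2)
qed

end
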